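(* Let $g>0$, $H>0$, $U=0$, $\Omega=[x_L,x_R]$, and let $h,u$ be a sufficiently smooth real-valued solution of the linearized Serre equations with $U=0$ on $\Omega\times[0,\infty)$, $$\frac{\partial h}{\partial t}+\frac{\partial}{\partial x}(Hu)=0,\qquad \frac{\partial u}{\partial t}+\frac{\partial}{\partial x}\left(gh-\frac{H^2}{3}\frac{\partial^2u}{\partial x\partial t}\right)=0,$$ with sufficiently smooth, compactly supported initial data $h(x,0)=f_h(x)$, $u(x,0)=f_u(x)$, and satisfying for all $t\ge 0$ the boundary conditions $$w_4(x_L,t)=\alpha\, w_5(x_L,t),\qquad w_5(x_R,t)=\beta\, w_4(x_R,t),$$ with real constants $\alpha,\beta$. If $-1\le\alpha\le1$ and $-1\le\beta\le1$, then $E(t)\le E(0)$ for all $t\ge0$.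
   Context: The energy is $E(t)=\frac g2\|h\|^2_{L^2(\Omega)}+\frac H2\|u\|^2_{L^2(\Omega)}+\frac{H^3}{6}\left\|\frac{\partial u}{\partial x}\right\|^2_{L^2(\Omega)}$. For a general constant background velocity $U$, put $S=\sqrt{4H^4+9U^2}$, $C^{\pm}=\sqrt{4H^4+(3U\pm S)^2}$ and $$w_4=\frac1{C^+}\left(2H^2U\frac{\partial^2u}{\partial x^2}+2H^2\frac{\partial^2u}{\partial x\partial t}-6gh-(3U+S)u\right),\quad w_5=\frac1{C^-}\left(2H^2U\frac{\partial^2u}{\partial x^2}+2H^2\frac{\partial^2u}{\partial x\partial t}-6gh-(3U-S)u\right).$$ Here they are used with $U=0$ (so $S=2H^2$). "Sufficiently smooth" means that all partial derivatives appearing exist, are continuous on $\Omega\times[0,\infty)$, and mixed partials commute. *)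

theory Defs
  imports "HOL-Analysis.Analysis"
begin

text \<open>Space-time functions are curried, with the space variable first. Derivatives are taken within
  \<^term>\<open>\<Omega> \<times> {0..}\<close>, hence are one-sided on its boundary. \<^const>\<open>vector_derivative\<close> yields an
  unspecified value where the derivative does not exist, so existence is always required separately.\<close>

definition pdx :: "real set \<Rightarrow> (real \<Rightarrow> real \<Rightarrow> real) \<Rightarrow> real \<Rightarrow> real \<Rightarrow> real" where
  "pdx \<Omega> f x t = vector_derivative (\<lambda>y. f y t) (at x within \<Omega>)"

definition pdt :: "(real \<Rightarrow> real \<Rightarrow> real) \<Rightarrow> real \<Rightarrow> real \<Rightarrow> real" where
  "pdt f x t = vector_derivative (\<lambda>s. f x s) (at t within {0..})"

definition has_cont_pdx :: "real set \<Rightarrow> (real \<Rightarrow> real \<Rightarrow> real) \<Rightarrow> bool" where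
  "has_cont_pdx \<Omega> f \<longleftrightarrow>
     (\<forall>x\<in>\<Omega>. \<forall>t\<ge>0. (\<lambda>y. f y t) differentiable (at x within \<Omega>)) \<and>
     continuous_on (\<Omega> \<times> {0..}) (\<lambda>(x, t). pdx \<Omega> f x t)"

definition has_cont_pdt :: "real set \<Rightarrow> (real \<Rightarrow> real \<Rightarrow> real) \<Rightarrow> bool" where
  "has_cont_pdt \<Omega> f \<longleftrightarrow>
     (\<forall>x\<in>\<Omega>. \<forall>t\<ge>0. (\<lambda>s. f x s) differentiable (at t within {0..})) \<and>
     continuous_on (\<Omega> \<times> {0..}) (\<lambda>(x, t). pdt f x t)"

text \<open>The derivatives occurring in the equations, the energy and the boundary variables are
  \<open>h\<^sub>x, h\<^sub>t, u\<^sub>x, u\<^sub>t, u\<^sub>x\<^sub>x, u\<^sub>x\<^sub>t, u\<^sub>x\<^sub>x\<^sub>t\<close>. For \<open>u\<^sub>x\<^sub>x\<^sub>t\<close>, the remaining order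
  \<^term>\<open>pdx \<Omega> (pdt (pdx \<Omega> u))\<close> agrees with \<^term>\<open>pdx \<Omega> (pdx \<Omega> (pdt u))\<close> by the second-order
  identity.\<close>

definition sufficiently_smooth ::
    "real set \<Rightarrow> (real \<Rightarrow> real \<Rightarrow> real) \<Rightarrow> (real \<Rightarrow> real \<Rightarrow> real) \<Rightarrow> bool" where
  "sufficiently_smooth \<Omega> h u \<longleftrightarrow>
     continuous_on (\<Omega> \<times> {0..}) (\<lambda>(x, t). h x t) \<and>
     continuous_on (\<Omega> \<times> {0..}) (\<lambda>(x, t). u x t) \<and>
     has_cont_pdx \<Omega> h \<and> has_cont_pdt \<Omega> h \<and>
     has_cont_pdx \<Omega> u \<and> has_cont_pdt \<Omega> u \<and>
     has_cont_pdx \<Omega> (pdx \<Omega> u) \<and>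
     has_cont_pdx \<Omega> (pdt u) \<and> has_cont_pdt \<Omega> (pdx \<Omega> u) \<and>
     has_cont_pdx \<Omega> (pdx \<Omega> (pdt u)) \<and> has_cont_pdt \<Omega> (pdx \<Omega> (pdx \<Omega> u)) \<and>
     (\<forall>x\<in>\<Omega>. \<forall>t\<ge>0. pdx \<Omega> (pdt u) x t = pdt (pdx \<Omega> u) x t) \<and>
     (\<forall>x\<in>\<Omega>. \<forall>t\<ge>0. pdx \<Omega> (pdx \<Omega> (pdt u)) x t = pdt (pdx \<Omega> (pdx \<Omega> u)) x t)"

text \<open>The linearized Serre equations with background velocity zero.\<close>

definition linear_serre ::
    "real \<Rightarrow> real \<Rightarrow> real set \<Rightarrow> (real \<Rightarrow> real \<Rightarrow> real) \<Rightarrow> (real \<Rightarrow> real \<Rightarrow> real) \<Rightarrow> bool" where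
  "linear_serre g H \<Omega> h u \<longleftrightarrow>
     (\<forall>x\<in>\<Omega>. \<forall>t\<ge>0.
        pdt h x t + pdx \<Omega> (\<lambda>x t. H * u x t) x t = 0 \<and>
        pdt u x t + pdx \<Omega> (\<lambda>x t. g * h x t - H^2 / 3 * pdx \<Omega> (pdt u) x t) x t = 0)"

definition L2_norm_on :: "real set \<Rightarrow> (real \<Rightarrow> real) \<Rightarrow> real" where
  "L2_norm_on \<Omega> f = sqrt (LINT x:\<Omega>|lborel. (f x)^2)"

definition energy ::
    "real \<Rightarrow> real \<Rightarrow> real set \<Rightarrow> (real \<Rightarrow> real \<Rightarrow> real) \<Rightarrow> (real \<Rightarrow> real \<Rightarrow> real) \<Rightarrow> real \<Rightarrow> real" where
  "energy g H \<Omega> h u t =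
     g / 2 * (L2_norm_on \<Omega> (\<lambda>x. h x t))^2 +
     H / 2 * (L2_norm_on \<Omega> (\<lambda>x. u x t))^2 +
     H^3 / 6 * (L2_norm_on \<Omega> (\<lambda>x. pdx \<Omega> u x t))^2"

definition char_S :: "real \<Rightarrow> real \<Rightarrow> real" where
  "char_S H U = sqrt (4 * H^4 + 9 * U^2)"

definition C_plus :: "real \<Rightarrow> real \<Rightarrow> real" where
  "C_plus H U = sqrt (4 * H^4 + (3 * U + char_S H U)^2)"

definition C_minus :: "real \<Rightarrow> real \<Rightarrow> real" where
  "C_minus H U = sqrt (4 * H^4 + (3 * U - char_S H U)^2)"

definition w4 ::
    "real \<Rightarrow> real \<Rightarrow> real \<Rightarrow> real set \<Rightarrow> (real \<Rightarrow> real \<Rightarrow> real) \<Rightarrow> (real \<Rightarrow> real \<Rightarrow> real) \<Rightarrow>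
     real \<Rightarrow> real \<Rightarrow> real" where
  "w4 g H U \<Omega> h u x t =
     1 / C_plus H U *
       (2 * H^2 * U * pdx \<Omega> (pdx \<Omega> u) x t + 2 * H^2 * pdx \<Omega> (pdt u) x t
         - 6 * g * h x t - (3 * U + char_S H U) * u x t)"

definition w5 ::
    "real \<Rightarrow> real \<Rightarrow> real \<Rightarrow> real set \<Rightarrow> (real \<Rightarrow> real \<Rightarrow> real) \<Rightarrow> (real \<Rightarrow> real \<Rightarrow> real) \<Rightarrow>
     real \<Rightarrow> real \<Rightarrow> real" where
  "w5 g H U \<Omega> h u x t =
     1 / C_minus H U *
       (2 * H^2 * U * pdx \<Omega> (pdx \<Omega> u) x t + 2 * H^2 * pdx \<Omega> (pdt u) x t
         - 6 * g * h x t - (3 * U - char_S H U) * u x t)"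

text \<open>A function on the line whose support is a compact subset of \<open>\<Omega>\<close>; for closed \<open>\<Omega>\<close> the support
  may reach the boundary.\<close>

definition compactly_supported_in :: "(real \<Rightarrow> real) \<Rightarrow> real set \<Rightarrow> bool" where
  "compactly_supported_in f \<Omega> \<longleftrightarrow>
     compact (closure {x. f x \<noteq> 0}) \<and> closure {x. f x \<noteq> 0} \<subseteq> \<Omega>"

end

theory Submission imports Defs begin

text \<open>Write \<open>p = gh - (H\<^sup>2/3)u\<^sub>x\<^sub>t\<close>, so that the equations read \<open>h\<^sub>t = -Hu\<^sub>x\<close> and \<open>u\<^sub>t = -p\<^sub>x\<close>.
  Differentiating the energy under the integral turns its density into \<open>-H(pu)\<^sub>x\<close>, so \<open>E'\<close> is the
  boundary flux \<open>H(pu)(x\<^sub>L) - H(pu)(x\<^sub>R)\<close>. Since \<open>pu\<close> is a positive multiple of \<open>w\<^sub>4\<^sup>2 - w\<^sub>5\<^sup>2\<close>, the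
  boundary conditions make both contributions nonpositive.\<close>

lemma has_cont_pdx_deriv:
  assumes "has_cont_pdx {a..b} f" "a < b" "x \<in> {a..b}" "t \<ge> 0"
  shows "((\<lambda>y. f y t) has_real_derivative pdx {a..b} f x t) (at x within {a..b})"
  using assms
  by (simp add: has_cont_pdx_def pdx_def vector_derivative_works
      has_real_derivative_iff_has_vector_derivative)

lemma has_cont_pdt_deriv:
  assumes "has_cont_pdt \<Omega> f" "x \<in> \<Omega>" "t \<ge> 0"
  shows "((\<lambda>s. f x s) has_real_derivative pdt f x t) (at t within {0..})"
  using assms
  by (simp add: has_cont_pdt_def pdt_def vector_derivative_works
      has_real_derivative_iff_has_vector_derivative)

text \<open>Derivatives within a nondegenerate interval are unique, even one-sidedly at its
  endpoints, so any computed derivative is the value that \<open>pdx\<close> selects.\<close>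

lemma pdx_eqI:
  assumes "((\<lambda>y. f y t) has_real_derivative D) (at x within {a..b})" "a < b" "x \<in> {a..b}"
  shows "pdx {a..b} f x t = D"
  using assms unfolding pdx_def cbox_interval[symmetric]
  by (intro vector_derivative_within_cbox)
    (auto simp: has_real_derivative_iff_has_vector_derivative)

lemma continuous_on_slice:
  assumes "continuous_on (A \<times> B) (\<lambda>(x, t). f x t)" "t \<in> B"
  shows "continuous_on A (\<lambda>x. f x t)"
proof -
  have "continuous_on A (\<lambda>x. (x, t))"
    by (intro continuous_intros)
  from continuous_on_compose2[OF assms(1) this] show ?thesis
    using assms(2) by auto
qed

text \<open>Continuity lets the Lebesgue integral be replaced by the gauge integral, for which the
  Leibniz rule and the fundamental theorem below are stated; the square root cancels because the
  integral is nonnegative.\<close>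

lemma L2_norm_on_power2:
  fixes f :: "real \<Rightarrow> real"
  assumes "continuous_on {a..b} f"
  shows "(L2_norm_on {a..b} f)\<^sup>2 = integral {a..b} (\<lambda>x. (f x)\<^sup>2)"
proof -
  have "set_integrable lborel {a..b} (\<lambda>x. (f x)\<^sup>2)"
    by (intro borel_integrable_atLeastAtMost' continuous_intros assms)
  then have "(LINT x:{a..b}|lborel. (f x)\<^sup>2) = integral {a..b} (\<lambda>x. (f x)\<^sup>2)"
    by (rule set_borel_integral_eq_integral)
  moreover have "integral {a..b} (\<lambda>x. (f x)\<^sup>2) \<ge> 0"
    by (rule integral_nonneg) (auto intro!: integrable_continuous_real continuous_intros assms)
  ultimately show ?thesis
    by (simp add: L2_norm_on_def)
qed

text \<open>The mean value argument needs two-sided derivatives only in the open interval, where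
  those within \<open>{0..}\<close> are two-sided. At time 0 the one-sided derivative still gives
  continuity.\<close>

lemma antimono_if_deriv_nonpos:
  fixes f :: "real \<Rightarrow> real"
  assumes deriv: "\<And>s. s \<ge> 0 \<Longrightarrow> (f has_real_derivative f' s) (at s within {0..})"
    and nonpos: "\<And>s. s \<ge> 0 \<Longrightarrow> f' s \<le> 0" and "t \<ge> 0"
  shows "f t \<le> f 0"
proof (rule DERIV_nonpos_imp_decreasing_open[OF \<open>t \<ge> 0\<close>])
  fix s :: real assume "0 < s" "s < t"
  then have "at s within {0..} = at s"
    by (intro at_within_interior) simp
  then show "\<exists>y. (f has_real_derivative y) (at s) \<and> y \<le> 0"
    using deriv[of s] nonpos[of s] \<open>0 < s\<close> by auto
next
  show "continuous_on {0..t} f"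
    by (rule DERIV_continuous_on[where D = f']) (auto intro: DERIV_subset[OF deriv])
qed

text \<open>For U = 0 both normalizing constants coincide, so the two variables are (a + b)/C and (a
  - b)/C with C^2 = 8 H^4, and the difference of their squares is 4ab/C^2.\<close>

lemma w5_power2_minus_w4_power2:
  assumes "H > 0"
  shows "(w5 g H 0 \<Omega> h u x t)\<^sup>2 - (w4 g H 0 \<Omega> h u x t)\<^sup>2 =
    - (6 / H\<^sup>2 * ((g * h x t - H\<^sup>2 / 3 * pdx \<Omega> (pdt u) x t) * u x t))"
proof -
  have S: "char_S H 0 = 2 * H\<^sup>2"
    unfolding char_S_def
    by (rule real_sqrt_unique) (simp_all add: power_mult_distrib flip: power_mult)
  have C: "(C_plus H 0)\<^sup>2 = 8 * H^4" "C_minus H 0 = C_plus H 0"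
    by (simp_all add: C_plus_def C_minus_def S power_mult_distrib flip: power_mult)
  \<comment> \<open>With p = gh - (H^2/3) u_xt, \<open>a\<close> is -6p and \<open>b\<close> is S u
    for S = 2 H^2; hence the product pu in the result.\<close>
  define a b where "a = 2 * H\<^sup>2 * pdx \<Omega> (pdt u) x t - 6 * g * h x t" and "b = 2 * H\<^sup>2 * u x t"
  have "w5 g H 0 \<Omega> h u x t = (a + b) / C_plus H 0" "w4 g H 0 \<Omega> h u x t = (a - b) / C_plus H 0"
    by (simp_all add: w4_def w5_def S C a_def b_def)
  then have "(w5 g H 0 \<Omega> h u x t)\<^sup>2 - (w4 g H 0 \<Omega> h u x t)\<^sup>2 =
      ((a + b)\<^sup>2 - (a - b)\<^sup>2) / (C_plus H 0)\<^sup>2"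
    by (simp only: power_divide flip: diff_divide_distrib)
  also have "\<dots> = a * b / (2 * H^4)"
    unfolding C by (simp add: power2_eq_square algebra_simps)
  also have "\<dots> = - (6 / H\<^sup>2 * ((g * h x t - H\<^sup>2 / 3 * pdx \<Omega> (pdt u) x t) * u x t))"
    using assms by (simp add: a_def b_def field_simps power2_eq_square power4_eq_xxxx)
  finally show ?thesis .
qed

lemma power2_le_if_eq_mult:
  fixes v w c :: real
  assumes "v = c * w" "-1 \<le> c" "c \<le> 1"
  shows "v\<^sup>2 \<le> w\<^sup>2"
proof -
  have "c\<^sup>2 \<le> 1" using assms by (simp add: abs_le_iff abs_square_le_1)
  then have "c\<^sup>2 * w\<^sup>2 \<le> 1 * w\<^sup>2" by (intro mult_right_mono) auto
  then show ?thesis using assms by (simp add: power_mult_distrib)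
qed

text \<open>Differentiation under the integral sign, applied below to each of the three squared
  norms in the energy.\<close>

lemma has_real_derivative_integral_power2:
  fixes f f' :: "real \<Rightarrow> real \<Rightarrow> real"
  assumes "\<And>x t. x \<in> {a..b} \<Longrightarrow> t \<ge> 0 \<Longrightarrow> ((\<lambda>s. f x s) has_real_derivative f' x t) (at t within {0..})"
    and cont: "continuous_on ({a..b} \<times> {0..}) (\<lambda>(x, t). f x t)"
    and cont': "continuous_on ({a..b} \<times> {0..}) (\<lambda>(x, t). f' x t)"
    and "t \<ge> 0"
  shows "((\<lambda>t. integral {a..b} (\<lambda>x. (f x t)\<^sup>2)) has_real_derivative
    integral {a..b} (\<lambda>x. 2 * f x t * f' x t)) (at t within {0..})"
proof -
  \<comment> \<open>The Leibniz rule wants continuity with the parameter, here time, as the first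
    coordinate, whereas the functions here take space first.\<close>
  have swap: "continuous_on ({0..} \<times> {a..b}) (\<lambda>(t, x). k x t)"
    if "continuous_on ({a..b} \<times> {0..}) (\<lambda>(x, t). k x t)" for k :: "real \<Rightarrow> real \<Rightarrow> real"
    using continuous_on_compose2[OF that continuous_on_swap, of "{0..} \<times> {a..b}"]
    by (simp add: product_swap case_prod_unfold)
  have "((\<lambda>t. integral (cbox a b) (\<lambda>x. (f x t)\<^sup>2)) has_real_derivative
      integral (cbox a b) (\<lambda>x. 2 * f x t * f' x t)) (at t within {0..})"
  proof (rule leibniz_rule_field_derivative)
    fix s x :: real assume "s \<in> {0..}" "x \<in> cbox a b"
    then show "((\<lambda>s. (f x s)\<^sup>2) has_real_derivative 2 * f x s * f' x s) (at s within {0..})"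
      by (auto intro!: derivative_eq_intros assms(1))
  next
    fix s :: real assume "s \<in> {0..}"
    then show "(\<lambda>x. (f x s)\<^sup>2) integrable_on cbox a b"
      by (auto intro!: integrable_continuous_real continuous_intros continuous_on_slice[OF cont])
  next
    show "continuous_on ({0..} \<times> cbox a b) (\<lambda>(s, x). 2 * f x s * f' x s)"
      using swap[OF cont] swap[OF cont']
      by (auto simp: case_prod_unfold intro!: continuous_intros)
  qed (use \<open>t \<ge> 0\<close> in auto)
  then show ?thesis by simp
qed

lemma has_real_derivative_energy:
  fixes g H a b :: real
  assumes "a < b" and smooth: "sufficiently_smooth {a..b} h u"
    and serre: "linear_serre g H {a..b} h u" and "t \<ge> 0"
  defines "p \<equiv> \<lambda>x t. g * h x t - H\<^sup>2 / 3 * pdx {a..b} (pdt u) x t"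
  shows "((\<lambda>t. energy g H {a..b} h u t) has_real_derivative
    H * (p a t * u a t - p b t * u b t)) (at t within {0..})"
proof -
  let ?\<Omega> = "{a..b}"
  note sm = smooth[unfolded sufficiently_smooth_def]
  have cont: "continuous_on (?\<Omega> \<times> {0..}) (\<lambda>(x, t). h x t)"
    "continuous_on (?\<Omega> \<times> {0..}) (\<lambda>(x, t). u x t)"
    "continuous_on (?\<Omega> \<times> {0..}) (\<lambda>(x, t). pdx ?\<Omega> u x t)"
    "continuous_on (?\<Omega> \<times> {0..}) (\<lambda>(x, t). pdt h x t)"
    "continuous_on (?\<Omega> \<times> {0..}) (\<lambda>(x, t). pdt u x t)"
    "continuous_on (?\<Omega> \<times> {0..}) (\<lambda>(x, t). pdt (pdx ?\<Omega> u) x t)"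
    using sm by (simp_all add: has_cont_pdx_def has_cont_pdt_def)
  have cont_t: "continuous_on ?\<Omega> (\<lambda>x. h x s)" "continuous_on ?\<Omega> (\<lambda>x. u x s)"
    "continuous_on ?\<Omega> (\<lambda>x. pdx ?\<Omega> u x s)" "continuous_on ?\<Omega> (\<lambda>x. pdt h x s)"
    "continuous_on ?\<Omega> (\<lambda>x. pdt u x s)" "continuous_on ?\<Omega> (\<lambda>x. pdt (pdx ?\<Omega> u) x s)"
    if "s \<ge> 0" for s
    using cont[THEN continuous_on_slice, of s] that by simp_all
  note dt = has_cont_pdt_deriv[of ?\<Omega>]
  note dx = has_cont_pdx_deriv[OF _ \<open>a < b\<close>]

  have energy_eq: "energy g H ?\<Omega> h u s = g / 2 * integral ?\<Omega> (\<lambda>x. (h x s)\<^sup>2) +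
      H / 2 * integral ?\<Omega> (\<lambda>x. (u x s)\<^sup>2) + H^3 / 6 * integral ?\<Omega> (\<lambda>x. (pdx ?\<Omega> u x s)\<^sup>2)"
    if "s \<ge> 0" for s
    by (simp add: energy_def L2_norm_on_power2 cont_t that)

  \<comment> \<open>The momentum equation turns the second term into -H u p_x. By the mass equation
    and u_xt = u_tx, the first and third become -gH h u_x + (H^3/3) u_x u_xt = -H p u_x; the weight
    H^3/6 is what makes p appear here.\<close>
  have integrand: "g / 2 * (2 * h x t * pdt h x t) + H / 2 * (2 * u x t * pdt u x t) +
      H^3 / 6 * (2 * pdx ?\<Omega> u x t * pdt (pdx ?\<Omega> u) x t) =
      - (H * (p x t * pdx ?\<Omega> u x t + pdx ?\<Omega> p x t * u x t))" if "x \<in> ?\<Omega>" for x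
  proof -
    have "pdx ?\<Omega> (\<lambda>x t. H * u x t) x t = H * pdx ?\<Omega> u x t"
      using sm that \<open>t \<ge> 0\<close> \<open>a < b\<close> by (intro pdx_eqI DERIV_cmult dx) auto
    then have "pdt h x t = - (H * pdx ?\<Omega> u x t)" and "pdt u x t = - pdx ?\<Omega> p x t"
      using serre that \<open>t \<ge> 0\<close> unfolding linear_serre_def p_def by (fastforce simp: eq_neg_iff_add_eq_0)+
    moreover have "pdt (pdx ?\<Omega> u) x t = pdx ?\<Omega> (pdt u) x t"
      using sm that \<open>t \<ge> 0\<close> by simp
    ultimately show ?thesis
      unfolding p_def by (simp add: field_simps power2_eq_square power3_eq_cube)
  qed

  \<comment> \<open>Differentiability of \<open>p\<close> in space comes from that of h and u_xt;
    uniqueness then rewrites the derivative as \<open>pdx ?\<Omega> p\<close>, the form in which the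
    momentum equation supplies it.\<close>
  have dp: "((\<lambda>y. p y t) has_real_derivative pdx ?\<Omega> p x t) (at x within ?\<Omega>)" if "x \<in> ?\<Omega>" for x
  proof -
    have "((\<lambda>y. p y t) has_real_derivative
        g * pdx ?\<Omega> h x t - H\<^sup>2 / 3 * pdx ?\<Omega> (pdx ?\<Omega> (pdt u)) x t) (at x within ?\<Omega>)"
      unfolding p_def using sm that \<open>t \<ge> 0\<close> by (intro DERIV_diff DERIV_cmult dx) auto
    then show ?thesis using pdx_eqI[where f = p] that \<open>a < b\<close> by metis
  qed
  \<comment> \<open>The product rule exhibits -H p u as an antiderivative, so only its endpoint
    values survive.\<close>
  have "((\<lambda>x. - (H * (p x t * pdx ?\<Omega> u x t + pdx ?\<Omega> p x t * u x t))) has_integral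
      - (H * (p b t * u b t)) - - (H * (p a t * u a t))) ?\<Omega>"
  proof (rule fundamental_theorem_of_calculus)
    fix x assume "x \<in> ?\<Omega>"
    then show "((\<lambda>x. - (H * (p x t * u x t))) has_vector_derivative
        - (H * (p x t * pdx ?\<Omega> u x t + pdx ?\<Omega> p x t * u x t))) (at x within ?\<Omega>)"
      unfolding has_real_derivative_iff_has_vector_derivative[symmetric]
      using sm \<open>t \<ge> 0\<close> by (auto intro!: derivative_eq_intros dp dx simp: algebra_simps)
  qed (use \<open>a < b\<close> in simp)
  then have flux: "integral ?\<Omega> (\<lambda>x. - (H * (p x t * pdx ?\<Omega> u x t + pdx ?\<Omega> p x t * u x t))) =
      H * (p a t * u a t - p b t * u b t)"
    by (simp add: integral_unique algebra_simps)

  have int: "(\<lambda>x. 2 * h x t * pdt h x t) integrable_on ?\<Omega>"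
    "(\<lambda>x. 2 * u x t * pdt u x t) integrable_on ?\<Omega>"
    "(\<lambda>x. 2 * pdx ?\<Omega> u x t * pdt (pdx ?\<Omega> u) x t) integrable_on ?\<Omega>"
    using cont_t[OF \<open>t \<ge> 0\<close>] by (auto intro!: integrable_continuous_real continuous_intros)
  have "((\<lambda>s. g / 2 * integral ?\<Omega> (\<lambda>x. (h x s)\<^sup>2) + H / 2 * integral ?\<Omega> (\<lambda>x. (u x s)\<^sup>2) +
        H^3 / 6 * integral ?\<Omega> (\<lambda>x. (pdx ?\<Omega> u x s)\<^sup>2)) has_real_derivative
      g / 2 * integral ?\<Omega> (\<lambda>x. 2 * h x t * pdt h x t) +
      H / 2 * integral ?\<Omega> (\<lambda>x. 2 * u x t * pdt u x t) +
      H^3 / 6 * integral ?\<Omega> (\<lambda>x. 2 * pdx ?\<Omega> u x t * pdt (pdx ?\<Omega> u) x t)) (at t within {0..})"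
    using sm \<open>t \<ge> 0\<close>
    by (intro DERIV_add DERIV_cmult has_real_derivative_integral_power2 cont dt) auto
  also have "g / 2 * integral ?\<Omega> (\<lambda>x. 2 * h x t * pdt h x t) +
      H / 2 * integral ?\<Omega> (\<lambda>x. 2 * u x t * pdt u x t) +
      H^3 / 6 * integral ?\<Omega> (\<lambda>x. 2 * pdx ?\<Omega> u x t * pdt (pdx ?\<Omega> u) x t) =
      integral ?\<Omega> (\<lambda>x. g / 2 * (2 * h x t * pdt h x t) + H / 2 * (2 * u x t * pdt u x t) +
        H^3 / 6 * (2 * pdx ?\<Omega> u x t * pdt (pdx ?\<Omega> u) x t))"
    using int by (simp only: integral_add integral_mult_right integrable_add integrable_on_mult_right)
  also have "\<dots> = H * (p a t * u a t - p b t * u b t)"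
    unfolding flux[symmetric] by (rule integral_cong) (rule integrand)
  \<comment> \<open>The integral formula for the energy is known only at nonnegative times, which
    suffices for a derivative within \<open>{0..}\<close>.\<close>
  finally show ?thesis
    unfolding has_field_derivative_def
    by (rule has_derivative_transform[rotated 2]) (use \<open>t \<ge> 0\<close> energy_eq in auto)
qed

theorem theorem2:
  fixes g H U xL xR \<alpha> \<beta> :: real
    and \<Omega> :: "real set"
    and h u :: "real \<Rightarrow> real \<Rightarrow> real"
    and f_h f_u :: "real \<Rightarrow> real"
  assumes "g > 0" and "H > 0" and "U = 0"
    and "xL < xR" and "\<Omega> = {xL..xR}"
    and "sufficiently_smooth \<Omega> h u"
    and "linear_serre g H \<Omega> h u"
    and "f_h C1_differentiable_on UNIV"
    and "f_u C1_differentiable_on UNIV" and "deriv f_u C1_differentiable_on UNIV"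
    and "compactly_supported_in f_h \<Omega>" and "compactly_supported_in f_u \<Omega>"
    and "\<And>x. x \<in> \<Omega> \<Longrightarrow> h x 0 = f_h x"
    and "\<And>x. x \<in> \<Omega> \<Longrightarrow> u x 0 = f_u x"
    and "\<And>t. t \<ge> 0 \<Longrightarrow> w4 g H U \<Omega> h u xL t = \<alpha> * w5 g H U \<Omega> h u xL t"
    and "\<And>t. t \<ge> 0 \<Longrightarrow> w5 g H U \<Omega> h u xR t = \<beta> * w4 g H U \<Omega> h u xR t"
    and "-1 \<le> \<alpha>" and "\<alpha> \<le> 1" and "-1 \<le> \<beta>" and "\<beta> \<le> 1"
  shows "\<forall>t\<ge>0. energy g H \<Omega> h u t \<le> energy g H \<Omega> h u 0"
proof (intro allI impI)
  define p where "p = (\<lambda>x t. g * h x t - H\<^sup>2 / 3 * pdx \<Omega> (pdt u) x t)"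
  have flux: "H * (p xL t * u xL t - p xR t * u xR t) \<le> 0" if "t \<ge> 0" for t
  proof -
    \<comment> \<open>The boundary conditions bound the square of w4 by that of w5 at
      \<open>xL\<close>, with the roles exchanged at \<open>xR\<close>. As the difference of squares
      is a negative multiple of pu, this gives pu the sign \<le> 0 on the left and \<ge> 0 on the
      right.\<close>
    have "(w4 g H 0 \<Omega> h u xL t)\<^sup>2 \<le> (w5 g H 0 \<Omega> h u xL t)\<^sup>2"
      by (rule power2_le_if_eq_mult[where c = \<alpha>]) (use assms that in auto)
    moreover have "(w5 g H 0 \<Omega> h u xR t)\<^sup>2 \<le> (w4 g H 0 \<Omega> h u xR t)\<^sup>2"
      by (rule power2_le_if_eq_mult[where c = \<beta>]) (use assms that in auto)
    ultimately have "6 / H\<^sup>2 * (p xL t * u xL t) \<le> 0" "0 \<le> 6 / H\<^sup>2 * (p xR t * u xR t)"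
      using w5_power2_minus_w4_power2[OF \<open>H > 0\<close>, of g \<Omega> h u _ t] unfolding p_def
      by (metis diff_ge_0_iff_ge neg_0_le_iff_le, metis diff_le_0_iff_le neg_le_0_iff_le)
    then have "p xL t * u xL t \<le> 0" "0 \<le> p xR t * u xR t"
      using \<open>H > 0\<close> by (simp_all add: divide_le_0_iff zero_le_divide_iff)
    then show ?thesis
      using \<open>H > 0\<close> by (intro mult_nonneg_nonpos) auto
  qed
  fix t :: real assume "t \<ge> 0"
  show "energy g H \<Omega> h u t \<le> energy g H \<Omega> h u 0"
  proof (rule antimono_if_deriv_nonpos[OF _ flux \<open>t \<ge> 0\<close>])
    fix s :: real assume "s \<ge> 0"
    then show "((\<lambda>t. energy g H \<Omega> h u t) has_real_derivative
        H * (p xL s * u xL s - p xR s * u xR s)) (at s within {0..})"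
      using has_real_derivative_energy[of xL xR h u g H s] assms by (simp add: p_def)
  qed
qed

end
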